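(* For an oriented link $L$, the function $[0,2]\to\mathbb{R}$, $t\mapsto s_t(L)$, is piecewise-linear and continuous in $t$, and is differentiable at all but finitely many points.
   Context: Fix a field $\mathbb{F}$. Let $R=\mathbb{F}[U,V]$ and $A=R[X]/((X-U)(X-V))$, a Frobenius algebra over $R$ with trace $\varepsilon:A\to R$, $\varepsilon(1)=0$, $\varepsilon(X)=1$, and comultiplication $\Delta(1)=X\otimes 1+1\otimes X-(U+V)1\otimes 1$, $\Delta(X)=X\otimes X-UV\,1\otimes 1$ (tensor products over $R$). Let $\mathcal{F}$ be the associated $(1+1)$-dimensional TQFT: $k$ disjoint circles in the plane are sent to $A^{\otimes k}$; merge saddles act by multiplication, split saddles by $\Delta$, births by the unit, deaths by $\varepsilon$. The grading $\operatorname{gr}$ on $A^{\otimes k}$ is additive over tensor factors with $\operatorname{gr}(1)=1$, $\operatorname{gr}(X)=-1$, and multiplication by $U$ or $V$ lowers it by $2$. Chain complex. Let $D$ be a diagram of an oriented link with crossings numbered $1,\dots,n$, of which $n_+$ are positive and $n_-$ negative. For $u\in\{0,1\}^n$ let $D_u$ be the collection of circles obtained by performing the $u_i$-smoothing at the $i$-th crossing (for a crossing drawn with over-strand running from bottom left to top right, the $0$-smoothing is the pair of vertical arcs $)($ and the $1$-smoothing is the pair of horizontal arcs). Put $|u|=\sum_i u_i$. Then $CKh(D)=\bigoplus_u \mathcal{F}(D_u)$ with $\mathcal{F}(D_u)$ in homological grading $|u|-n_-$; the differential is the sum, over edges $u\to v$ of the cube (one entry changed from $0$ to $1$), of $\pm\mathcal{F}$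 of the saddle cobordism $D_u\to D_v$, with signs making every square anticommute. The Khovanov generators $Kg_0(D)$ are the elements $g=g_1\otimes\cdots\otimes g_k\in\mathcal{F}(D_u)$ with $g_i\in\{1,X\}$; they form an $R$-basis, with $\operatorname{gr}_q(g)=\operatorname{gr}(g)+|u|+n_+-2n_-$. Let $Kg(D)=\{U^mV^ng : g\in Kg_0(D),\ m,n\ge 0\}$, an $\mathbb{F}$-basis of $CKh(D)$. $Kh(D)$ is the homology of $CKh(D)$, and $T(D)\subset Kh(D)$ is the submodule of $R$-torsion elements. The invariant. For $t\in[0,2]$ put $\operatorname{gr}_t(U^mV^ng)=\operatorname{gr}_q(g)-(tm+(2-t)n)$ for $U^mV^ng\in Kg(D)$; for nonzero $z\in CKh(D)$ let $\operatorname{gr}_t(z)$ be the minimum of $\operatorname{gr}_t$ over the elements of $Kg(D)$ occurring in $z$ with nonzero coefficient. For $\bar\eta\in Kh(D)/T(D)$ nonzero let $\operatorname{gr}_t(\bar\eta)=\sup\operatorname{gr}_t(z)$ over all cycles $z$ whose homology class projects to $\bar\eta$ (the induced filtration grading). Define $\operatorname{gr}_t(D)=\sup\{\operatorname{gr}_t(\bar\eta): 0\ne\bar\eta\in Kh(D)/T(D)\}$ and $s_t(D)=\operatorname{gr}_t(D)-1$. Then $s_t(L):=s_t(D)$ for any diagram $D$ of $L$; this is independent of the choice of diagram. *)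

theory Defs
  imports "HOL-Analysis.Analysis" "HOL-Computational_Algebra.Polynomial"
begin

section \<open>Oriented link diagrams\<close>

text \<open>
  Oriented planar diagram codes. The four edges meeting at a crossing are listed counterclockwise,
  starting with the incoming end of the under-strand, so the under-strand runs from
  \<open>under_in\<close> to \<open>under_out\<close>. The over-strand runs from \<open>left\<close> to \<open>right\<close> at a positive crossing and
  from \<open>right\<close> to \<open>left\<close> at a negative one. An edge that meets no crossing is a closed circle
  (a crossingless component, whose orientation plays no role).
\<close>

datatype crossing =
  Crossing (positive: bool) (under_in: nat) (right: nat) (under_out: nat) (left: nat)

datatype link_diagram = Diagram (edges: "nat set") (crossings: "crossing list")

definition slots :: "crossing \<Rightarrow> nat list" where
  "slots c = [under_in c, right c, under_out c, left c]"

definition incoming :: "crossing \<Rightarrow> nat set" where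
  "incoming c = (if positive c then {0, 3} else {0, 1})"

definition num_crossings :: "link_diagram \<Rightarrow> nat" where
  "num_crossings D = length (crossings D)"

definition n_pos :: "link_diagram \<Rightarrow> nat" where
  "n_pos D = length (filter positive (crossings D))"

definition n_neg :: "link_diagram \<Rightarrow> nat" where
  "n_neg D = length (filter (\<lambda>c. \<not> positive c) (crossings D))"

text \<open>A dart \<open>(i, s)\<close> is the end of an edge at slot \<open>s\<close> of crossing \<open>i\<close>.\<close>

definition darts :: "link_diagram \<Rightarrow> (nat \<times> nat) set" where
  "darts D = {..<num_crossings D} \<times> {..<4}"

definition edge_at :: "link_diagram \<Rightarrow> nat \<times> nat \<Rightarrow> nat" where
  "edge_at D d = slots (crossings D ! fst d) ! snd d"

definition in_darts :: "link_diagram \<Rightarrow> (nat \<times> nat) set" where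
  "in_darts D = {(i, s) \<in> darts D. s \<in> incoming (crossings D ! i)}"

text \<open>The classes of the equivalence relation on \<open>S\<close> generated by \<open>r\<close>.\<close>

definition generated_classes :: "'b set \<Rightarrow> ('b \<times> 'b) set \<Rightarrow> 'b set set" where
  "generated_classes S r = S // {(x, y) \<in> S \<times> S. (x, y) \<in> (r \<union> r\<inverse>)\<^sup>*}"

text \<open>
  The faces of the underlying 4-valent graph (circles without crossings left aside): leave a
  crossing along an edge, arrive at its other end, and turn into the next edge there.
\<close>

definition faces :: "link_diagram \<Rightarrow> (nat \<times> nat) set set" where
  "faces D = generated_classes (darts D)
     {(d, (j, Suc s mod 4)) | d j s.
        d \<in> darts D \<and> (j, s) \<in> darts D \<and> d \<noteq> (j, s) \<and> edge_at D d = edge_at D (j, s)}"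

definition graph_components :: "link_diagram \<Rightarrow> (nat \<times> nat) set set" where
  "graph_components D = generated_classes (darts D)
     {(d, d') \<in> darts D \<times> darts D. fst d = fst d' \<or> edge_at D d = edge_at D d'}"

text \<open>
  Planarity is Euler's formula: with \<open>n\<close> vertices and \<open>2n\<close> edges, \<open>n - 2n + F = 2c\<close> holds iff each
  of the \<open>c\<close> connected components of the graph (whose Euler characteristic is at most 2) is
  embedded in a sphere.
\<close>

definition oriented_link_diagram :: "link_diagram \<Rightarrow> bool" where
  "oriented_link_diagram D \<longleftrightarrow>
     finite (edges D) \<and>
     edge_at D ` darts D \<subseteq> edges D \<and>
     (\<forall>e \<in> edge_at D ` darts D.
        (\<exists>!d. d \<in> in_darts D \<and> edge_at D d = e) \<and>
        (\<exists>!d. d \<in> darts D - in_darts D \<and> edge_at D d = e)) \<and>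
     card (faces D) = num_crossings D + 2 * card (graph_components D)"


section \<open>The Frobenius algebra\<close>

text \<open>
  \<open>R = F[U,V]\<close> is the iterated polynomial ring \<open>F[V][U]\<close>, and \<open>A\<close> is the free \<open>R\<close>-module on the
  basis \<open>1, X\<close>.
\<close>

definition varU :: "'a::field poly poly" where "varU = [:0, 1:]"

definition varV :: "'a::field poly poly" where "varV = [:[:0, 1:]:]"

definition coeffUV :: "'a::field poly poly \<Rightarrow> nat \<Rightarrow> nat \<Rightarrow> 'a" where
  "coeffUV p m n = coeff (coeff p m) n"

lemma coeffUV_monomial:
  "coeffUV (varU ^ k * varV ^ l * [:[:c:]:]) m n = (if m = k \<and> n = l then c else 0)"
proof -
  have U: "varU ^ k = (monom 1 k :: 'a poly poly)"
    by (simp add: varU_def monom_altdef)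
  have V: "varV ^ l = ([:monom 1 l:] :: 'a poly poly)"
    by (induction l) (simp_all add: varV_def monom_altdef one_pCons)
  have "varU ^ k * varV ^ l * [:[:c:]:] = monom (monom c l) k"
    by (simp add: U V smult_monom monom_0 [symmetric] mult_monom)
  then show ?thesis by (auto simp: coeffUV_def)
qed

datatype label = AOne | AX

text \<open>\<open>mult_coeff a b c\<close> is the coefficient of \<open>c\<close> in the product \<open>ab\<close>, using
  \<open>X\<^sup>2 = (U + V) X - U V\<close>.\<close>

fun mult_coeff :: "label \<Rightarrow> label \<Rightarrow> label \<Rightarrow> 'a::field poly poly" where
  "mult_coeff AOne b c = (if b = c then 1 else 0)"
| "mult_coeff AX AOne c = (if c = AX then 1 else 0)"
| "mult_coeff AX AX AOne = - (varU * varV)"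
| "mult_coeff AX AX AX = varU + varV"

fun basis_poly :: "label \<Rightarrow> 'a::field poly poly poly" where
  "basis_poly AOne = 1"
| "basis_poly AX = [:0, 1:]"

lemma mult_coeff_correct:
  "[:- varU, 1:] * [:- varV, 1:] dvd
     basis_poly a * basis_poly b
       - (smult (mult_coeff a b AOne) (basis_poly AOne) + smult (mult_coeff a b AX) (basis_poly AX))"
proof (cases "a = AX \<and> b = AX")
  case True
  then show ?thesis by (simp add: algebra_simps)
next
  case False
  then have "basis_poly a * basis_poly b
       - (smult (mult_coeff a b AOne) (basis_poly AOne) + smult (mult_coeff a b AX) (basis_poly AX))
       = (0 :: 'a poly poly poly)"
    by (cases a; cases b) simp_all
  then show ?thesis by simp
qed

text \<open>\<open>comult_coeff a b c\<close> is the coefficient of \<open>b \<otimes> c\<close> in \<open>\<Delta>(a)\<close>.\<close>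

fun comult_coeff :: "label \<Rightarrow> label \<Rightarrow> label \<Rightarrow> 'a::field poly poly" where
  "comult_coeff AOne AOne AOne = - (varU + varV)"
| "comult_coeff AOne AOne AX = 1"
| "comult_coeff AOne AX AOne = 1"
| "comult_coeff AOne AX AX = 0"
| "comult_coeff AX AOne AOne = - (varU * varV)"
| "comult_coeff AX AOne AX = 0"
| "comult_coeff AX AX AOne = 0"
| "comult_coeff AX AX AX = 1"

fun gr_basis :: "label \<Rightarrow> int" where
  "gr_basis AOne = 1"
| "gr_basis AX = -1"


section \<open>The cube of resolutions\<close>

text \<open>
  A vertex \<open>u\<close> of the cube is a list of Booleans, \<open>True\<close> standing for 1. Turning a crossing so that
  the over-strand runs from bottom left to top right puts its slots at the bottom right, top right,
  top left and bottom left (or at the opposite corners), so the vertical arcs join slots 0, 1 and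
  slots 2, 3, the horizontal arcs slots 1, 2 and slots 3, 0.
\<close>

definition vertices :: "link_diagram \<Rightarrow> bool list set" where
  "vertices D = {u. length u = num_crossings D}"

definition weight :: "bool list \<Rightarrow> nat" where
  "weight u = length (filter id u)"

definition smoothing_arcs :: "crossing \<Rightarrow> bool \<Rightarrow> (nat \<times> nat) set" where
  "smoothing_arcs c b =
     (if b then {(right c, under_out c), (left c, under_in c)}
      else {(under_in c, right c), (under_out c, left c)})"

text \<open>A circle of \<open>D\<^sub>u\<close> is represented by the set of edges it traverses.\<close>

definition circles :: "link_diagram \<Rightarrow> bool list \<Rightarrow> nat set set" where
  "circles D u =
     generated_classes (edges D) (\<Union>i<num_crossings D. smoothing_arcs (crossings D ! i) (u ! i))"

definition circle_of :: "link_diagram \<Rightarrow> bool list \<Rightarrow> nat \<Rightarrow> nat set" where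
  "circle_of D u e = (THE C. C \<in> circles D u \<and> e \<in> C)"

text \<open>A Khovanov generator is a vertex \<open>u\<close> with a labelling of the circles of \<open>D\<^sub>u\<close> by \<open>1\<close> and \<open>X\<close>.\<close>

type_synonym generator = "bool list \<times> (nat set \<Rightarrow> label)"

definition Kg0 :: "link_diagram \<Rightarrow> generator set" where
  "Kg0 D = (SIGMA u : vertices D. circles D u \<rightarrow>\<^sub>E UNIV)"

definition gr_q :: "link_diagram \<Rightarrow> generator \<Rightarrow> int" where
  "gr_q D = (\<lambda>(u, g). (\<Sum>C \<in> circles D u. gr_basis (g C))
     + int (weight u) + int (n_pos D) - 2 * int (n_neg D))"

text \<open>
  The matrix entry from \<open>g\<close> to \<open>h\<close> of the saddle at crossing \<open>i\<close>, from \<open>D\<^sub>u\<close> (where \<open>u\<^sub>i = 0\<close>) to the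
  vertex with \<open>u\<^sub>i\<close> changed to 1. Slots 0 and 2 lie on the two different arcs of either smoothing,
  so their circles in \<open>D\<^sub>u\<close> and \<open>D\<^sub>v\<close> are the ones taking part in the saddle. Since the diagram is
  planar the saddle is a merge or a split, and the last alternative does not occur.
\<close>

definition saddle :: "link_diagram \<Rightarrow> bool list \<Rightarrow> nat \<Rightarrow> (nat set \<Rightarrow> label) \<Rightarrow> (nat set \<Rightarrow> label)
    \<Rightarrow> 'a::field poly poly" where
  "saddle D u i g h =
     (let v = u[i := True];
          a = under_in (crossings D ! i);
          b = under_out (crossings D ! i)
      in if \<exists>C \<in> circles D u \<inter> circles D v. g C \<noteq> h C then 0
         else if circle_of D u a \<noteq> circle_of D u b
           then mult_coeff (g (circle_of D u a)) (g (circle_of D u b)) (h (circle_of D v a))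
         else if circle_of D v a \<noteq> circle_of D v b
           then comult_coeff (g (circle_of D u a)) (h (circle_of D v a)) (h (circle_of D v b))
         else 0)"

text \<open>
  \<open>\<sigma> u i\<close> is the sign of the edge of the cube that starts at \<open>u\<close> and changes \<open>u\<^sub>i\<close> from 0 to 1.
  Since the unsigned squares of the cube commute, the signed ones anticommute under this condition.
\<close>

definition anticommuting_signs :: "link_diagram \<Rightarrow> (bool list \<Rightarrow> nat \<Rightarrow> int) \<Rightarrow> bool" where
  "anticommuting_signs D \<sigma> \<longleftrightarrow>
     (\<forall>u \<in> vertices D. \<forall>i < num_crossings D. \<not> u ! i \<longrightarrow> \<sigma> u i \<in> {1, -1}) \<and>
     (\<forall>u \<in> vertices D. \<forall>i < num_crossings D. \<forall>j < num_crossings D.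
        i \<noteq> j \<and> \<not> u ! i \<and> \<not> u ! j \<longrightarrow>
        \<sigma> u i * \<sigma> (u[i := True]) j = - (\<sigma> u j * \<sigma> (u[j := True]) i))"

lemma standard_signs: "anticommuting_signs D (\<lambda>u i. (-1) ^ weight (take i u))"
proof -
  have flip: "weight (take j (u[i := True])) = Suc (weight (take j u))"
    if "i < j" "j < length u" "\<not> u ! i" for u :: "bool list" and i j
  proof -
    have 1: "take j u = take i u @ False # drop (Suc i) (take j u)"
      using that id_take_nth_drop[of i "take j u"] by (simp add: min_def)
    have 2: "take j (u[i := True]) = take i u @ True # drop (Suc i) (take j u)"
      using that upd_conv_take_nth_drop[of i "take j u" True]
      by (simp add: take_update_swap min_def)
    show ?thesis
      unfolding 2 by (subst (2) 1) (simp add: weight_def)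
  qed
  have keep: "weight (take j (u[i := True])) = weight (take j u)" if "j < i" for u :: "bool list" and i j
    using that by simp
  have "(-1::int) ^ weight (take i u) * (-1) ^ weight (take j (u[i := True])) =
      - ((-1) ^ weight (take j u) * (-1) ^ weight (take i (u[j := True])))"
    if "i \<noteq> j" "\<not> u ! i" "\<not> u ! j" "i < length u" "j < length u" for u i j
  proof (cases "i < j")
    case True
    then show ?thesis using flip[of i j u] keep[of i j u] that by simp
  next
    case False
    then show ?thesis using flip[of j i u] keep[of j i u] that by simp
  qed
  moreover have "(-1::int) ^ k = 1 \<or> (-1::int) ^ k = -1" for k :: nat
    by (cases "even k") simp_all
  ultimately show ?thesis
    unfolding anticommuting_signs_def vertices_def
    by (intro conjI ballI allI impI) (simp_all only: mem_Collect_eq insert_iff empty_iff simp_thms)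
qed


section \<open>Khovanov homology and its torsion-free quotient\<close>

type_synonym 'a chain = "generator \<Rightarrow> 'a poly poly"

definition CKh :: "link_diagram \<Rightarrow> 'a::field chain set" where
  "CKh D = {z. \<forall>g. g \<notin> Kg0 D \<longrightarrow> z g = 0}"

definition differential :: "link_diagram \<Rightarrow> (bool list \<Rightarrow> nat \<Rightarrow> int) \<Rightarrow> 'a::field chain \<Rightarrow> 'a chain"
  where "differential D \<sigma> z = (\<lambda>(v, h). if (v, h) \<in> Kg0 D
     then \<Sum>(u, g) \<in> Kg0 D. \<Sum>i | i < num_crossings D \<and> \<not> u ! i \<and> v = u[i := True].
            of_int (\<sigma> u i) * saddle D u i g h * z (u, g)
     else 0)"

definition cycles :: "link_diagram \<Rightarrow> (bool list \<Rightarrow> nat \<Rightarrow> int) \<Rightarrow> 'a::field chain set" where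
  "cycles D \<sigma> = {z \<in> CKh D. differential D \<sigma> z = (\<lambda>_. 0)}"

definition boundaries :: "link_diagram \<Rightarrow> (bool list \<Rightarrow> nat \<Rightarrow> int) \<Rightarrow> 'a::field chain set" where
  "boundaries D \<sigma> = differential D \<sigma> ` CKh D"

definition homologous :: "link_diagram \<Rightarrow> (bool list \<Rightarrow> nat \<Rightarrow> int) \<Rightarrow> ('a::field chain \<times> 'a chain) set"
  where "homologous D \<sigma> =
     {(z, w) \<in> cycles D \<sigma> \<times> cycles D \<sigma>. (\<lambda>g. z g - w g) \<in> boundaries D \<sigma>}"

definition Kh :: "link_diagram \<Rightarrow> (bool list \<Rightarrow> nat \<Rightarrow> int) \<Rightarrow> 'a::field chain set set" where
  "Kh D \<sigma> = cycles D \<sigma> // homologous D \<sigma>"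

definition kh_class :: "link_diagram \<Rightarrow> (bool list \<Rightarrow> nat \<Rightarrow> int) \<Rightarrow> 'a::field chain \<Rightarrow> 'a chain set"
  where "kh_class D \<sigma> z = homologous D \<sigma> `` {z}"

definition torsion :: "link_diagram \<Rightarrow> (bool list \<Rightarrow> nat \<Rightarrow> int) \<Rightarrow> 'a::field chain set set" where
  "torsion D \<sigma> = {\<eta> \<in> Kh D \<sigma>. \<exists>r z. r \<noteq> 0 \<and> z \<in> \<eta> \<and>
     kh_class D \<sigma> (\<lambda>g. r * z g) = kh_class D \<sigma> (\<lambda>_. 0)}"

definition equal_mod_torsion ::
  "link_diagram \<Rightarrow> (bool list \<Rightarrow> nat \<Rightarrow> int) \<Rightarrow> ('a::field chain set \<times> 'a chain set) set" where
  "equal_mod_torsion D \<sigma> = {(\<eta>, \<theta>) \<in> Kh D \<sigma> \<times> Kh D \<sigma>.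
     \<exists>z \<in> \<eta>. \<exists>w \<in> \<theta>. kh_class D \<sigma> (\<lambda>g. z g - w g) \<in> torsion D \<sigma>}"

definition Kh_mod_T :: "link_diagram \<Rightarrow> (bool list \<Rightarrow> nat \<Rightarrow> int) \<Rightarrow> 'a::field chain set set set" where
  "Kh_mod_T D \<sigma> = Kh D \<sigma> // equal_mod_torsion D \<sigma>"

definition proj_class ::
  "link_diagram \<Rightarrow> (bool list \<Rightarrow> nat \<Rightarrow> int) \<Rightarrow> 'a::field chain \<Rightarrow> 'a chain set set" where
  "proj_class D \<sigma> z = equal_mod_torsion D \<sigma> `` {kh_class D \<sigma> z}"


section \<open>The invariant\<close>

text \<open>\<open>gr_t_gen D t m n g\<close> is \<open>gr\<^sub>t(U\<^sup>m V\<^sup>n g)\<close>.\<close>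

definition gr_t_gen :: "link_diagram \<Rightarrow> real \<Rightarrow> nat \<Rightarrow> nat \<Rightarrow> generator \<Rightarrow> real" where
  "gr_t_gen D t m n g = of_int (gr_q D g) - (t * real m + (2 - t) * real n)"

text \<open>For a nonzero chain the minimum is over a finite nonempty set.\<close>

definition gr_t_chain :: "link_diagram \<Rightarrow> real \<Rightarrow> 'a::field chain \<Rightarrow> real" where
  "gr_t_chain D t z = Min {gr_t_gen D t m n g | m n g. g \<in> Kg0 D \<and> coeffUV (z g) m n \<noteq> 0}"

text \<open>
  For \<open>0 \<le> t \<le> 2\<close> both suprema below are bounded above by the largest \<open>gr\<^sub>q(g)\<close>, since \<open>U\<close> and \<open>V\<close>
  do not raise \<open>gr\<^sub>t\<close>; and \<open>Kh/T\<close> of a link diagram is nonzero.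
\<close>

definition gr_t_class :: "link_diagram \<Rightarrow> (bool list \<Rightarrow> nat \<Rightarrow> int) \<Rightarrow> real
    \<Rightarrow> 'a::field chain set set \<Rightarrow> real" where
  "gr_t_class D \<sigma> t \<eta> = (SUP z \<in> {z \<in> cycles D \<sigma>. proj_class D \<sigma> z = \<eta>}. gr_t_chain D t z)"

text \<open>The first argument of \<open>gr_t\<close> and \<open>s_t\<close> only fixes the field.\<close>

definition gr_t :: "'a::field itself \<Rightarrow> link_diagram \<Rightarrow> (bool list \<Rightarrow> nat \<Rightarrow> int) \<Rightarrow> real \<Rightarrow> real" where
  "gr_t _ D \<sigma> t =
     (SUP \<eta> \<in> (Kh_mod_T D \<sigma> :: 'a chain set set set) - {proj_class D \<sigma> (\<lambda>_. 0)}.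
        gr_t_class D \<sigma> t \<eta>)"

definition s_t :: "'a::field itself \<Rightarrow> link_diagram \<Rightarrow> (bool list \<Rightarrow> nat \<Rightarrow> int) \<Rightarrow> real \<Rightarrow> real" where
  "s_t F D \<sigma> t = gr_t F D \<sigma> t - 1"

text \<open>Affine on the open intervals of a finite subdivision; continuity is not included.\<close>

definition piecewise_linear_on :: "real \<Rightarrow> real \<Rightarrow> (real \<Rightarrow> real) \<Rightarrow> bool" where
  "piecewise_linear_on a b f \<longleftrightarrow>
     (\<exists>N p. p 0 = a \<and> p N = b \<and> (\<forall>i<N. p i < p (Suc i)) \<and>
        (\<forall>i<N. \<exists>k c. \<forall>t \<in> {p i<..<p (Suc i)}. f t = k * t + c))"

end

theory Submission
  imports Defs
begin

text \<open>
  Unwinding the two suprema, \<open>gr\<^sub>t(D)\<close> is the supremum of \<open>gr\<^sub>t(z)\<close> over all cycles \<open>z\<close> whose class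
  is nonzero modulo torsion, and each \<open>gr\<^sub>t(z)\<close> is the minimum of finitely many functions that are
  affine in \<open>t\<close>, one for each monomial \<open>U\<^sup>m V\<^sup>n g\<close> of \<open>z\<close>. The difficulty is that there are
  infinitely many cycles, with exponents of arbitrary size; a supremum of infinitely many such
  functions could have breakpoints accumulating at \<open>t = 0\<close> or \<open>t = 2\<close>, where multiplication by a
  power of \<open>U\<close>, respectively of \<open>V\<close>, costs nothing.

  The point is that finitely many cycles already realise the supremum for all \<open>t \<in> [0,2]\<close> at once
  (\<open>finitely_many_realise_sup\<close>). Fix one such cycle \<open>z\<^sub>0\<close>. As \<open>tm + (2 - t)n \<ge> 2 min(m, n)\<close>, there is \<open>N\<close>
  such that a cycle containing a monomial with \<open>m > N\<close> and \<open>n > N\<close> is never better than \<open>z\<^sub>0\<close>. In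
  every other cycle each monomial has \<open>m \<le> N\<close> or \<open>n \<le> N\<close>, so the outline of its Newton diagram is
  given by finitely many natural numbers: for every generator \<open>g\<close> and \<open>k \<le> N\<close>, the largest
  exponent of \<open>U\<close> occurring with \<open>V\<^sup>k g\<close> and the largest exponent of \<open>V\<close> occurring with \<open>U\<^sup>k g\<close>.
  Enlarging these numbers can only lower \<open>gr\<^sub>t\<close>, for every \<open>t\<close>; and by Dickson's lemma
  (\<open>dickson\<close>) finitely many of the cycles have outlines that bound those of all the others
  from below.

  So \<open>gr\<^sub>t(D)\<close> is a maximum of finitely many minima of finitely many affine functions. It is
  continuous and agrees at every \<open>t\<close> with one of finitely many affine functions, and can change
  from one to another only where two of them cross (\<open>affine_off_crossings\<close>).
\<close>


section \<open>Finitely many cycles suffice\<close>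

text \<open>
  Dickson's lemma for vectors indexed by \<open>I\<close>. Add one coordinate \<open>i\<close> at a time: if \<open>T\<close> works for
  the old coordinates, it still works for the elements whose new coordinate is at least a bound
  \<open>M\<close> for its values on \<open>T\<close>, and the others fall into \<open>M\<close> sets on which the new coordinate is constant.
\<close>

lemma dickson:
  fixes \<phi> :: "'i \<Rightarrow> 'z \<Rightarrow> nat"
  assumes "finite I"
  shows "\<exists>T \<subseteq> Z. finite T \<and> (\<forall>z \<in> Z. \<exists>w \<in> T. \<forall>i \<in> I. \<phi> i w \<le> \<phi> i z)"
  using assms
proof (induction I arbitrary: Z)
  case empty
  show ?case
  proof (cases "Z = {}")
    case False
    then obtain z where "z \<in> Z" by blast
    then show ?thesis by (intro exI[of _ "{z}"]) auto
  qed auto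
next
  case (insert i I)
  obtain T where T: "T \<subseteq> Z" "finite T" "\<forall>z \<in> Z. \<exists>w \<in> T. \<forall>j \<in> I. \<phi> j w \<le> \<phi> j z"
    using insert.IH[of Z] by auto
  obtain M where M: "\<forall>w \<in> T. \<phi> i w \<le> M"
    using finite_nat_set_iff_bounded_le[of "\<phi> i ` T"] T(2) by auto
  have "\<forall>k. \<exists>S \<subseteq> {z \<in> Z. \<phi> i z = k}. finite S \<and>
      (\<forall>z \<in> {z \<in> Z. \<phi> i z = k}. \<exists>w \<in> S. \<forall>j \<in> I. \<phi> j w \<le> \<phi> j z)"
    using insert.IH by blast
  from choice[OF this] obtain S where "\<forall>k. S k \<subseteq> {z \<in> Z. \<phi> i z = k} \<and> finite (S k) \<and>
      (\<forall>z \<in> {z \<in> Z. \<phi> i z = k}. \<exists>w \<in> S k. \<forall>j \<in> I. \<phi> j w \<le> \<phi> j z)" ..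
  then have S: "\<And>k. S k \<subseteq> {z \<in> Z. \<phi> i z = k}" "\<And>k. finite (S k)"
      "\<And>k z. z \<in> Z \<Longrightarrow> \<phi> i z = k \<Longrightarrow> \<exists>w \<in> S k. \<forall>j \<in> I. \<phi> j w \<le> \<phi> j z"
    by blast+
  have "\<exists>w \<in> T \<union> (\<Union>k<M. S k). \<forall>j \<in> insert i I. \<phi> j w \<le> \<phi> j z" if z: "z \<in> Z" for z
  proof (cases "\<phi> i z < M")
    case True
    obtain w where w: "w \<in> S (\<phi> i z)" "\<forall>j \<in> I. \<phi> j w \<le> \<phi> j z"
      using S(3)[OF z refl] by blast
    moreover have "\<phi> i w \<le> \<phi> i z"
      using w(1) S(1) by fastforce
    moreover have "w \<in> T \<union> (\<Union>k<M. S k)" using w(1) True by blast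
    ultimately show ?thesis by (intro bexI[of _ w]) simp_all
  next
    case False
    obtain w where w: "w \<in> T" "\<forall>j \<in> I. \<phi> j w \<le> \<phi> j z"
      using T(3) z by blast
    moreover have "\<phi> i w \<le> \<phi> i z"
      using M w(1) False by (meson leI le_trans)
    ultimately show ?thesis by (intro bexI[of _ w]) simp_all
  qed
  moreover have "T \<union> (\<Union>k<M. S k) \<subseteq> Z"
    using T(1) S(1) by fast
  moreover have "finite (T \<union> (\<Union>k<M. S k))"
    using T(2) S(2) by simp
  ultimately show ?case by (intro exI[of _ "T \<union> (\<Union>k<M. S k)"]) blast
qed

definition monomial_grade :: "('g \<Rightarrow> real) \<Rightarrow> real \<Rightarrow> 'g \<times> nat \<times> nat \<Rightarrow> real" where
  "monomial_grade q t = (\<lambda>(g, m, n). q g - (t * real m + (2 - t) * real n))"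

lemma monomial_grade_antimono:
  assumes "m \<le> m'" "n \<le> n'" "t \<in> {0..2}"
  shows "monomial_grade q t (g, m', n') \<le> monomial_grade q t (g, m, n)"
proof -
  have "t * real m + (2 - t) * real n \<le> t * real m' + (2 - t) * real n'"
    using assms by (intro add_mono mult_left_mono) auto
  then show ?thesis by (simp add: monomial_grade_def)
qed

text \<open>
  Index \<open>(True, g, k)\<close> measures the row of exponents of \<open>U\<close> occurring with \<open>V\<^sup>k g\<close>, index
  \<open>(False, g, k)\<close> the column of exponents of \<open>V\<close> occurring with \<open>U\<^sup>k g\<close>. The value is one more than
  the largest exponent, so that 0 is left for an empty row or column.
\<close>

definition outline :: "('g \<times> nat \<times> nat) set \<Rightarrow> bool \<times> 'g \<times> nat \<Rightarrow> nat" where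
  "outline S = (\<lambda>(horiz, g, k).
     Sup (Suc ` {l. (if horiz then (g, l, k) else (g, k, l)) \<in> S}))"

lemma less_outline_iff:
  assumes "finite S"
  shows "l < outline S (horiz, g, k) \<longleftrightarrow>
    (\<exists>l' \<ge> l. (if horiz then (g, l', k) else (g, k, l')) \<in> S)"
proof -
  let ?L = "{l. (if horiz then (g, l, k) else (g, k, l)) \<in> S}"
  have "?L \<subseteq> (if horiz then fst \<circ> snd else snd \<circ> snd) ` S"
    by (force split: if_splits)
  then have fin: "finite ?L" using assms by (rule finite_surj[rotated])
  show ?thesis
  proof (cases "?L = {}")
    case True
    then show ?thesis by (simp add: outline_def)
  next
    case False
    then have "Suc ` ?L \<noteq> {}" by blast
    then have "outline S (horiz, g, k) = Max (Suc ` ?L)"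
      unfolding outline_def Sup_nat_def prod.case by (rule if_not_P)
    then show ?thesis
      using False fin by (auto simp: Max_gr_iff less_Suc_eq_le)
  qed
qed

text \<open>
  A monomial of \<open>S\<close> minimising the grading lies in one of the rows or columns that the outline
  records, so \<open>S'\<close> has a monomial at least as low.
\<close>

lemma Min_grade_le_of_outline_le:
  assumes S: "finite S" "S \<noteq> {}" "\<And>g m n. (g, m, n) \<in> S \<Longrightarrow> g \<in> G \<and> (m \<le> N \<or> n \<le> N)"
    and S': "finite S'"
    and le: "\<forall>i \<in> UNIV \<times> G \<times> {..N}. outline S i \<le> outline S' i"
    and t: "t \<in> {0..2}"
  shows "Min (monomial_grade q t ` S') \<le> Min (monomial_grade q t ` S)"
proof -
  have "Min (monomial_grade q t ` S) \<in> monomial_grade q t ` S"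
    using S by (intro Min_in) auto
  then obtain g m n where gmn: "(g, m, n) \<in> S"
      "Min (monomial_grade q t ` S) = monomial_grade q t (g, m, n)"
    by auto
  have "\<exists>m' n'. (g, m', n') \<in> S' \<and> m \<le> m' \<and> n \<le> n'"
  proof (cases "n \<le> N")
    case True
    have "m < outline S (True, g, n)"
      using gmn(1) by (auto simp: less_outline_iff[OF S(1)])
    also have "\<dots> \<le> outline S' (True, g, n)"
      using le True S(3)[OF gmn(1)] by auto
    finally show ?thesis by (auto simp: less_outline_iff[OF S'])
  next
    case False
    have "n < outline S (False, g, m)"
      using gmn(1) by (auto simp: less_outline_iff[OF S(1)])
    also have "\<dots> \<le> outline S' (False, g, m)"
      using le False S(3)[OF gmn(1)] by auto
    finally show ?thesis by (auto simp: less_outline_iff[OF S'])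
  qed
  then obtain m' n' where m'n': "(g, m', n') \<in> S'" "m \<le> m'" "n \<le> n'" by blast
  have "Min (monomial_grade q t ` S') \<le> monomial_grade q t (g, m', n')"
    using S' m'n'(1) by auto
  also have "\<dots> \<le> monomial_grade q t (g, m, n)"
    using m'n' t by (intro monomial_grade_antimono)
  finally show ?thesis using gmn(2) by simp
qed

text \<open>
  Here \<open>S z\<close> is the set of monomials of \<open>z\<close>. One finite set \<open>T\<close> serves all \<open>t\<close>: it consists of the
  reference element \<open>z\<^sub>0\<close> and of the elements with minimal outline among those confined to
  \<open>min(m, n) \<le> N\<close>.
\<close>

lemma finitely_many_realise_sup:
  fixes S :: "'z \<Rightarrow> ('g \<times> nat \<times> nat) set" and q :: "'g \<Rightarrow> real"
  assumes G: "finite G"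
    and S: "\<And>z. z \<in> Z \<Longrightarrow> finite (S z) \<and> S z \<noteq> {} \<and> S z \<subseteq> G \<times> UNIV"
    and Z: "Z \<noteq> {}"
  obtains T where "T \<subseteq> Z" "finite T" "T \<noteq> {}"
    "\<And>z. z \<in> Z \<Longrightarrow> \<exists>w \<in> T. \<forall>t \<in> {0..2}.
       Min (monomial_grade q t ` S z) \<le> Min (monomial_grade q t ` S w)"
proof -
  obtain z0 where z0: "z0 \<in> Z" using Z by blast
  define C where "C = Min ((\<lambda>(g, m, n). q g - (2 * real m + 2 * real n)) ` S z0)"
  have C: "C \<le> Min (monomial_grade q t ` S z0)" if t: "t \<in> {0..2}" for t
  proof -
    have "C \<le> monomial_grade q t s" if s: "s \<in> S z0" for s
    proof -
      obtain g m n where [simp]: "s = (g, m, n)" by (cases s)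
      have "C \<le> q g - (2 * real m + 2 * real n)"
        unfolding C_def using S[OF z0] s by (intro Min_le) force+
      also have "\<dots> \<le> monomial_grade q t s"
      proof -
        have "t * real m + (2 - t) * real n \<le> 2 * real m + 2 * real n"
          using t by (intro add_mono mult_right_mono) auto
        then show ?thesis by (simp add: monomial_grade_def)
      qed
      finally show ?thesis .
    qed
    then show ?thesis using S[OF z0] by auto
  qed
  obtain Q where Q: "\<And>g. g \<in> G \<Longrightarrow> q g \<le> Q"
    using G by (meson bdd_above.E bdd_above_finite finite_imageI imageI)
  obtain N :: nat where N: "Q - C \<le> 2 * real N"
    using real_arch_simple[of "(Q - C) / 2"] by (auto simp: mult.commute)
  define Z' where "Z' = {z \<in> Z. \<forall>(g, m, n) \<in> S z. m \<le> N \<or> n \<le> N}"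
  obtain T where T: "T \<subseteq> Z'" "finite T"
      "\<forall>z \<in> Z'. \<exists>w \<in> T. \<forall>i \<in> UNIV \<times> G \<times> {..N}. outline (S w) i \<le> outline (S z) i"
    using dickson[of "UNIV \<times> G \<times> {..N}" Z' "\<lambda>i z. outline (S z) i"] G by auto
  have "\<exists>w \<in> insert z0 T. \<forall>t \<in> {0..2}.
      Min (monomial_grade q t ` S z) \<le> Min (monomial_grade q t ` S w)" if z: "z \<in> Z" for z
  proof (cases "z \<in> Z'")
    case True
    then obtain w where w: "w \<in> T" "\<forall>i \<in> UNIV \<times> G \<times> {..N}. outline (S w) i \<le> outline (S z) i"
      using T(3) by blast
    have "w \<in> Z'" using w(1) T(1) by blast
    then have "w \<in> Z" and "\<forall>(g, m, n) \<in> S w. m \<le> N \<or> n \<le> N"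
      by (auto simp: Z'_def)
    then have "Min (monomial_grade q t ` S z) \<le> Min (monomial_grade q t ` S w)"
      if "t \<in> {0..2}" for t
      using S z w(2) that by (intro Min_grade_le_of_outline_le[where G = G and N = N]) blast+
    then show ?thesis using w(1) by blast
  next
    case False
    then obtain g m n where gmn: "(g, m, n) \<in> S z" "N < m" "N < n"
      using z by (force simp: Z'_def)
    have "Min (monomial_grade q t ` S z) \<le> Min (monomial_grade q t ` S z0)" if t: "t \<in> {0..2}" for t
    proof -
      have "Min (monomial_grade q t ` S z) \<le> monomial_grade q t (g, m, n)"
        using S[OF z] gmn(1) by auto
      also have "\<dots> \<le> monomial_grade q t (g, N, N)"
        using gmn t by (intro monomial_grade_antimono) auto
      also have "\<dots> = q g - 2 * real N"
        by (simp add: monomial_grade_def algebra_simps)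
      also have "\<dots> \<le> C"
        using N Q[of g] S[OF z] gmn(1) by force
      also have "\<dots> \<le> Min (monomial_grade q t ` S z0)" by (rule C[OF t])
      finally show ?thesis .
    qed
    then show ?thesis by blast
  qed
  moreover have "insert z0 T \<subseteq> Z" using z0 T(1) by (auto simp: Z'_def)
  ultimately show ?thesis using T(2) that[of "insert z0 T"] by blast
qed


section \<open>Continuous functions that select among finitely many affine functions\<close>

text \<open>
  Off the crossings the sets where \<open>f\<close> agrees with the various affine functions are pairwise
  disjoint. They are closed and finite in number, so by connectedness one of them is everything.
\<close>

lemma affine_off_crossings:
  fixes f :: "real \<Rightarrow> real" and L :: "(real \<times> real) set"
  assumes L: "finite L" and J: "connected J"
    and f: "continuous_on J f" "\<And>t. t \<in> J \<Longrightarrow> \<exists>(k, c) \<in> L. f t = k * t + c"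
    and off: "\<And>t k c k' c'. t \<in> J \<Longrightarrow> (k, c) \<in> L \<Longrightarrow> (k', c') \<in> L \<Longrightarrow>
      k * t + c = k' * t + c' \<Longrightarrow> (k, c) = (k', c')"
  shows "\<exists>k c. \<forall>t \<in> J. f t = k * t + c"
proof (cases "J = {}")
  case False
  then obtain t0 where t0: "t0 \<in> J" by blast
  define E where "E l = {t \<in> J. f t = fst l * t + snd l}" for l
  have closed: "closedin (top_of_set J) (E l)" for l
  proof -
    have "E l = {t \<in> J. f t - (fst l * t + snd l) = 0}" by (auto simp: E_def)
    moreover have "continuous_on J (\<lambda>t. f t - (fst l * t + snd l))"
      by (intro continuous_intros f)
    ultimately show ?thesis
      using continuous_closedin_preimage_constant[of J "\<lambda>t. f t - (fst l * t + snd l)" 0] by simp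
  qed
  obtain l where l: "l \<in> L" "t0 \<in> E l"
    using f(2)[OF t0] t0 by (force simp: E_def)
  have "J - E l = (\<Union>l' \<in> L - {l}. E l')"
  proof
    show "J - E l \<subseteq> (\<Union>l' \<in> L - {l}. E l')"
    proof
      fix t assume "t \<in> J - E l"
      moreover from this obtain k c where "(k, c) \<in> L" "f t = k * t + c"
        using f(2)[of t] by blast
      ultimately show "t \<in> (\<Union>l' \<in> L - {l}. E l')"
        by (intro UN_I[of "(k, c)"]) (auto simp: E_def)
    qed
    show "(\<Union>l' \<in> L - {l}. E l') \<subseteq> J - E l"
    proof
      fix t assume "t \<in> (\<Union>l' \<in> L - {l}. E l')"
      then obtain l' where l': "l' \<in> L" "l' \<noteq> l" "t \<in> E l'" by blast
      have "t \<notin> E l"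
        using off[of t "fst l" "snd l" "fst l'" "snd l'"] l(1) l' by (auto simp: E_def)
      then show "t \<in> J - E l" using l'(3) by (simp add: E_def)
    qed
  qed
  moreover have "closedin (top_of_set J) (\<Union>l' \<in> L - {l}. E l')"
    using L closed by (intro closedin_Union) auto
  ultimately have "openin (top_of_set J) (E l)"
    by (auto simp: openin_closedin_eq E_def)
  then have "E l = J"
    using J closed[of l] l(2) by (auto simp: connected_clopen)
  then show ?thesis by (auto simp: E_def)
qed auto

lemma piecewise_linear_on_of_breakpoints:
  assumes P: "finite P" and ab: "a < b"
    and f: "\<And>x y. a \<le> x \<Longrightarrow> x < y \<Longrightarrow> y \<le> b \<Longrightarrow> {x<..<y} \<inter> P = {} \<Longrightarrow>
      \<exists>k c. \<forall>t \<in> {x<..<y}. f t = k * t + c"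
  shows "piecewise_linear_on a b f"
proof -
  define P' where "P' = insert a (insert b (P \<inter> {a..b}))"
  define xs where "xs = sorted_list_of_set P'"
  have "finite P'" using P by (simp add: P'_def)
  then have set: "set xs = P'" and sorted: "sorted_wrt (<) xs"
    by (simp_all add: xs_def)
  have mono: "xs ! i < xs ! j" if "i < j" "j < length xs" for i j
    using sorted that by (auto simp: sorted_wrt_iff_nth_less)
  have range: "a \<le> xs ! i" "xs ! i \<le> b" if "i < length xs" for i
  proof -
    have "xs ! i \<in> P'" using that set nth_mem by blast
    then show "a \<le> xs ! i" "xs ! i \<le> b" using ab by (auto simp: P'_def)
  qed
  obtain i j where ij: "i < length xs" "xs ! i = a" "j < length xs" "xs ! j = b"
    using set by (metis P'_def in_set_conv_nth insertI1 insertI2)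
  have "xs ! 0 = a"
    using mono[of 0 i] range[of 0] ij by (cases "i = 0") force+
  moreover have "xs ! (length xs - 1) = b"
    using mono[of j "length xs - 1"] range[of "length xs - 1"] ij
    by (cases "j = length xs - 1") force+
  moreover have "\<exists>k c. \<forall>t \<in> {xs ! i<..<xs ! Suc i}. f t = k * t + c" if i: "i < length xs - 1" for i
  proof (rule f)
    show "a \<le> xs ! i" "xs ! Suc i \<le> b" "xs ! i < xs ! Suc i"
      using i by (auto intro!: range mono)
    have False if x: "x \<in> {xs ! i<..<xs ! Suc i}" "x \<in> P" for x
    proof -
      have "a \<le> xs ! i" "xs ! Suc i \<le> b" using i by (auto intro!: range)
      then have "x \<in> P'" using x by (auto simp: P'_def)
      then obtain j where j: "j < length xs" "xs ! j = x"
        using set by (metis in_set_conv_nth)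
      moreover have "i < length xs" using i by simp
      ultimately have "\<not> j \<le> i" "\<not> Suc i \<le> j"
        using x(1) mono[of j i] mono[of "Suc i" j] by (auto simp: le_less)
      then show False by simp
    qed
    then show "{xs ! i<..<xs ! Suc i} \<inter> P = {}" by blast
  qed
  ultimately show ?thesis
    unfolding piecewise_linear_on_def using mono
    by (intro exI[of _ "length xs - 1"] exI[of _ "(!) xs"]) auto
qed

lemma finite_nondifferentiable_of_breakpoints:
  fixes f :: "real \<Rightarrow> real"
  assumes P: "finite P"
    and f: "\<And>x y. a \<le> x \<Longrightarrow> x < y \<Longrightarrow> y \<le> b \<Longrightarrow> {x<..<y} \<inter> P = {} \<Longrightarrow>
      \<exists>k c. \<forall>t \<in> {x<..<y}. f t = k * t + c"
  shows "finite {t \<in> {a..b}. \<not> f differentiable (at t within {a..b})}"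
proof (rule finite_subset)
  show "finite (P \<union> {a, b})" using P by simp
  have "f differentiable (at t within {a..b})" if t: "t \<in> {a<..<b} - P" for t
  proof -
    have "open ({a<..<b} - P)" using P by (intro open_Diff finite_imp_closed) auto
    then obtain e where e: "e > 0" "ball t e \<subseteq> {a<..<b} - P"
      using t by (meson openE)
    have ball: "ball t e = {t - e<..<t + e}" by (rule ball_eq_greaterThanLessThan)
    have "{t - e..t + e} \<subseteq> {a..b}"
    proof -
      have "closure {t - e<..<t + e} \<subseteq> closure {a<..<b}"
        using e ball by (intro closure_mono) auto
      then show ?thesis using e(1) t by (simp add: closure_greaterThanLessThan)
    qed
    then have "a \<le> t - e" "t + e \<le> b" using e(1) by auto
    then obtain k c where kc: "\<forall>s \<in> {t - e<..<t + e}. f s = k * s + c"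
      using f[of "t - e" "t + e"] e ball by auto
    have "((\<lambda>s. k * s + c) has_real_derivative k) (at t)"
      by (auto intro!: derivative_eq_intros)
    then have "(f has_real_derivative k) (at t)"
      by (rule DERIV_cong_ev[THEN iffD1, rotated -1])
         (use kc e(1) in \<open>auto simp: eventually_nhds intro!: exI[of _ "{t - e<..<t + e}"]\<close>)
    then show ?thesis
      by (meson differentiable_at_withinI real_differentiable_def)
  qed
  then show "{t \<in> {a..b}. \<not> f differentiable (at t within {a..b})} \<subseteq> P \<union> {a, b}"
    by force
qed

lemma continuous_affine_selection:
  fixes f :: "real \<Rightarrow> real" and L :: "(real \<times> real) set"
  assumes L: "finite L" and ab: "a < b"
    and f: "continuous_on {a..b} f" "\<And>t. t \<in> {a..b} \<Longrightarrow> \<exists>(k, c) \<in> L. f t = k * t + c"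
  shows "piecewise_linear_on a b f"
    and "finite {t \<in> {a..b}. \<not> f differentiable (at t within {a..b})}"
proof -
  \<comment> \<open>The crossings of the affine functions, together with a stray 0 from the parallel ones.\<close>
  define P where "P = (\<lambda>((k, c), (k', c')). (c' - c) / (k - k')) ` (L \<times> L)"
  have P: "finite P" using L by (simp add: P_def)
  have affine: "\<exists>k c. \<forall>t \<in> {x<..<y}. f t = k * t + c"
    if xy: "a \<le> x" "x < y" "y \<le> b" "{x<..<y} \<inter> P = {}" for x y
  proof (rule affine_off_crossings[OF L])
    show "continuous_on {x<..<y} f"
      using f(1) by (rule continuous_on_subset) (use xy in auto)
    show "\<exists>(k, c) \<in> L. f t = k * t + c" if "t \<in> {x<..<y}" for t
      using f(2)[of t] that xy by auto
    show "(k, c) = (k', c')"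
      if "t \<in> {x<..<y}" "(k, c) \<in> L" "(k', c') \<in> L" "k * t + c = k' * t + c'" for t k c k' c'
    proof (rule ccontr)
      assume "(k, c) \<noteq> (k', c')"
      then have "k \<noteq> k'" using that(4) by auto
      then have "t = (c' - c) / (k - k')" using that(4) by (simp add: field_simps)
      then have "t \<in> P" using that(2,3) by (force simp: P_def)
      then show False using that(1) xy(4) by blast
    qed
  qed simp
  show "piecewise_linear_on a b f"
    using P ab affine by (rule piecewise_linear_on_of_breakpoints)
  show "finite {t \<in> {a..b}. \<not> f differentiable (at t within {a..b})}"
    using P affine by (rule finite_nondifferentiable_of_breakpoints)
qed

lemma continuous_on_Min_image:
  fixes f :: "'s \<Rightarrow> 'x::topological_space \<Rightarrow> 'y::linorder_topology"
  assumes "finite S" "S \<noteq> {}" "\<And>s. s \<in> S \<Longrightarrow> continuous_on A (f s)"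
  shows "continuous_on A (\<lambda>x. Min ((\<lambda>s. f s x) ` S))"
  using assms by (induction S rule: finite_ne_induct) (auto intro!: continuous_on_min)

lemma continuous_on_Max_image:
  fixes f :: "'s \<Rightarrow> 'x::topological_space \<Rightarrow> 'y::linorder_topology"
  assumes "finite S" "S \<noteq> {}" "\<And>s. s \<in> S \<Longrightarrow> continuous_on A (f s)"
  shows "continuous_on A (\<lambda>x. Max ((\<lambda>s. f s x) ` S))"
  using assms by (induction S rule: finite_ne_induct) (auto intro!: continuous_on_max)


section \<open>The grading as a maximum over cycles\<close>

lemma finite_Kg0:
  assumes "finite (edges D)"
  shows "finite (Kg0 D)"
proof -
  have "finite (vertices D)"
    using finite_lists_length_eq[of "UNIV :: bool set" "num_crossings D"] by (simp add: vertices_def)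
  moreover have "finite (circles D u)" for u
    using assms unfolding circles_def generated_classes_def
    by (intro finite_quotient) auto
  moreover have "finite (UNIV :: label set)"
  proof -
    have "(UNIV :: label set) = {AOne, AX}" using label.exhaust by blast
    then show ?thesis by (metis finite.emptyI finite.insertI)
  qed
  ultimately show ?thesis
    unfolding Kg0_def by (intro finite_SigmaI finite_PiE) auto
qed

definition monomials :: "link_diagram \<Rightarrow> 'a::field chain \<Rightarrow> (generator \<times> nat \<times> nat) set" where
  "monomials D z = {(g, m, n). g \<in> Kg0 D \<and> coeffUV (z g) m n \<noteq> 0}"

lemma finite_monomials:
  assumes "finite (Kg0 D)"
  shows "finite (monomials D z)"
proof (rule finite_subset)
  show "monomials D z \<subseteq> (SIGMA g : Kg0 D. SIGMA m : {..degree (z g)}. {..degree (coeff (z g) m)})"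
    by (force simp: monomials_def coeffUV_def intro: le_degree)
  show "finite (SIGMA g : Kg0 D. SIGMA m : {..degree (z g)}. {..degree (coeff (z g) m)})"
    using assms by auto
qed

lemma monomials_nonempty:
  assumes "z \<in> CKh D" "z \<noteq> (\<lambda>_. 0)"
  shows "monomials D z \<noteq> {}"
proof -
  obtain g where g: "z g \<noteq> 0" using assms(2) by blast
  then have "g \<in> Kg0 D" using assms(1) unfolding CKh_def by blast
  moreover obtain m where "coeff (z g) m \<noteq> 0" using g by (metis leading_coeff_0_iff)
  moreover from this obtain n where "coeff (coeff (z g) m) n \<noteq> 0" by (metis leading_coeff_0_iff)
  ultimately have "(g, m, n) \<in> monomials D z" by (simp add: monomials_def coeffUV_def)
  then show ?thesis by blast
qed

lemma gr_t_chain_eq_Min: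
  "gr_t_chain D t z = Min (monomial_grade (\<lambda>g. of_int (gr_q D g)) t ` monomials D z)"
proof -
  have "{gr_t_gen D t m n g | m n g. g \<in> Kg0 D \<and> coeffUV (z g) m n \<noteq> 0} =
      monomial_grade (\<lambda>g. of_int (gr_q D g)) t ` monomials D z"
    by (force simp: monomials_def monomial_grade_def gr_t_gen_def)
  then show ?thesis by (simp add: gr_t_chain_def)
qed

definition nontorsion_cycles ::
  "link_diagram \<Rightarrow> (bool list \<Rightarrow> nat \<Rightarrow> int) \<Rightarrow> 'a::field chain set" where
  "nontorsion_cycles D \<sigma> = {z \<in> cycles D \<sigma>. proj_class D \<sigma> z \<noteq> proj_class D \<sigma> (\<lambda>_. 0)}"

lemma nonzero_classes_eq:
  "Kh_mod_T D \<sigma> - {proj_class D \<sigma> (\<lambda>_. 0)} = proj_class D \<sigma> ` nontorsion_cycles D \<sigma>"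
  by (auto simp: Kh_mod_T_def Kh_def quotient_def proj_class_def kh_class_def nontorsion_cycles_def)

text \<open>
  A finite family dominating all nontorsion cycles bounds both suprema in the definition of \<open>gr\<^sub>t\<close>
  and is contained in the cycles they range over, so the nested supremum is its maximum.
\<close>

lemma gr_t_eq_Max:
  fixes T :: "'a::field chain set"
  assumes T: "T \<subseteq> nontorsion_cycles D \<sigma>" "finite T" "T \<noteq> {}"
    and dom: "\<And>z :: 'a chain. z \<in> nontorsion_cycles D \<sigma> \<Longrightarrow> \<exists>w \<in> T. gr_t_chain D t z \<le> gr_t_chain D t w"
  shows "gr_t TYPE('a) D \<sigma> t = Max (gr_t_chain D t ` T)"
proof -
  let ?M = "Max (gr_t_chain D t ` T)"
  let ?E = "proj_class D \<sigma> ` (nontorsion_cycles D \<sigma> :: 'a chain set)"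
  have le_M: "gr_t_chain D t z \<le> ?M" if "z \<in> nontorsion_cycles D \<sigma>" for z :: "'a chain"
    using dom[OF that] T(2) by (meson Max_ge finite_imageI imageI order_trans)
  have rep: "z \<in> nontorsion_cycles D \<sigma>"
    if "\<eta> \<in> ?E" "z \<in> cycles D \<sigma>" "proj_class D \<sigma> z = \<eta>" for z :: "'a chain" and \<eta>
    using that by (auto simp: nontorsion_cycles_def)
  have class_le: "gr_t_class D \<sigma> t \<eta> \<le> ?M" if "\<eta> \<in> ?E" for \<eta>
    unfolding gr_t_class_def
  proof (rule cSUP_least)
    show "{z \<in> cycles D \<sigma>. proj_class D \<sigma> z = \<eta>} \<noteq> {}"
      using that by (auto simp: nontorsion_cycles_def)
  qed (use rep[OF that] le_M in blast)
  have "Max (gr_t_chain D t ` T) \<in> gr_t_chain D t ` T"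
    using T by (intro Max_in) auto
  then obtain w where w: "w \<in> T" "?M = gr_t_chain D t w" by auto
  then have w': "w \<in> nontorsion_cycles D \<sigma>" using T(1) by blast
  have gr: "gr_t TYPE('a) D \<sigma> t = (SUP \<eta> \<in> ?E. gr_t_class D \<sigma> t \<eta>)"
    by (simp add: gr_t_def nonzero_classes_eq)
  have "?M \<le> gr_t_class D \<sigma> t (proj_class D \<sigma> w)"
    unfolding gr_t_class_def w(2)
  proof (rule cSUP_upper)
    show "bdd_above (gr_t_chain D t ` {z \<in> cycles D \<sigma>. proj_class D \<sigma> z = proj_class D \<sigma> w})"
      using rep[of "proj_class D \<sigma> w"] w' le_M by (intro bdd_aboveI2[where M = ?M]) blast
  qed (use w' in \<open>auto simp: nontorsion_cycles_def\<close>)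
  also have "\<dots> \<le> gr_t TYPE('a) D \<sigma> t"
    unfolding gr using w' class_le by (intro cSUP_upper bdd_aboveI2[where M = ?M]) auto
  finally have "?M \<le> gr_t TYPE('a) D \<sigma> t" .
  moreover have "gr_t TYPE('a) D \<sigma> t \<le> ?M"
    unfolding gr using w' class_le by (intro cSUP_least) auto
  ultimately show ?thesis by simp
qed

text \<open>
  If there is no nontorsion cycle, the supremum is over the empty set for every \<open>t\<close>, so \<open>s\<^sub>t\<close> is a
  constant.
\<close>

lemma s_t_continuous_affine_selection:
  assumes "finite (edges D)"
  obtains L :: "(real \<times> real) set" where "finite L"
    "continuous_on {0..2} (s_t TYPE('a::field) D \<sigma>)"
    "\<And>t. t \<in> {0..2} \<Longrightarrow> \<exists>(k, c) \<in> L. s_t TYPE('a) D \<sigma> t = k * t + c"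
proof (cases "nontorsion_cycles D \<sigma> = ({} :: 'a chain set)")
  case True
  then have "s_t TYPE('a) D \<sigma> = (\<lambda>t. Sup {} - 1)"
    by (simp add: s_t_def gr_t_def nonzero_classes_eq fun_eq_iff)
  then show ?thesis by (intro that[of "{(0, Sup {} - 1)}"]) auto
next
  case False
  let ?q = "\<lambda>g. real_of_int (gr_q D g)"
  let ?Z = "nontorsion_cycles D \<sigma> :: 'a chain set"
  have G: "finite (Kg0 D)" using assms by (rule finite_Kg0)
  have mono: "finite (monomials D z) \<and> monomials D z \<noteq> {} \<and> monomials D z \<subseteq> Kg0 D \<times> UNIV"
    if "z \<in> ?Z" for z
    using that finite_monomials[OF G, of z] monomials_nonempty[of z D]
    by (auto simp: nontorsion_cycles_def cycles_def monomials_def)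
  obtain T where T: "T \<subseteq> ?Z" "finite T" "T \<noteq> {}"
    and dom: "\<And>z. z \<in> ?Z \<Longrightarrow> \<exists>w \<in> T. \<forall>t \<in> {0..2}.
       Min (monomial_grade ?q t ` monomials D z) \<le> Min (monomial_grade ?q t ` monomials D w)"
    using finitely_many_realise_sup[of "Kg0 D" ?Z "monomials D" ?q] G mono False by blast
  have s_t: "s_t TYPE('a) D \<sigma> t = Max (gr_t_chain D t ` T) - 1" if "t \<in> {0..2}" for t
  proof -
    have "gr_t TYPE('a) D \<sigma> t = Max (gr_t_chain D t ` T)"
      using T that by (intro gr_t_eq_Max) (auto simp: gr_t_chain_eq_Min dest!: dom)
    then show ?thesis by (simp add: s_t_def)
  qed
  define L where "L = (\<lambda>(g, m, n). (real n - real m, ?q g - 2 * real n - 1)) ` (\<Union>w \<in> T. monomials D w)"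
  show ?thesis
  proof (rule that)
    show "finite L"
      unfolding L_def using T(1,2) mono by (intro finite_imageI finite_UN_I) blast+
    have chain: "continuous_on {0..2} (\<lambda>t. gr_t_chain D t w)" if "w \<in> T" for w
      unfolding gr_t_chain_eq_Min
    proof (rule continuous_on_Min_image)
      show "finite (monomials D w)" "monomials D w \<noteq> {}" using mono T that by auto
    qed (auto simp: monomial_grade_def split_beta intro!: continuous_intros)
    have "continuous_on {0..2} (\<lambda>t. Max (gr_t_chain D t ` T) - 1)"
      using T by (intro continuous_on_diff continuous_on_Max_image chain) auto
    then show "continuous_on {0..2} (s_t TYPE('a) D \<sigma>)"
      by (rule continuous_on_cong[THEN iffD1, rotated -1]) (simp_all add: s_t)
    fix t :: real assume t: "t \<in> {0..2}"
    have "Max (gr_t_chain D t ` T) \<in> gr_t_chain D t ` T"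
      using T by (intro Max_in) auto
    then obtain w where w: "w \<in> T" "Max (gr_t_chain D t ` T) = gr_t_chain D t w" by auto
    have "gr_t_chain D t w \<in> monomial_grade ?q t ` monomials D w"
      unfolding gr_t_chain_eq_Min using mono T w(1) by (intro Min_in) auto
    then obtain g m n where "(g, m, n) \<in> monomials D w"
        "gr_t_chain D t w = monomial_grade ?q t (g, m, n)" by auto
    then show "\<exists>(k, c) \<in> L. s_t TYPE('a) D \<sigma> t = k * t + c"
      using w t unfolding L_def
      by (intro bexI[of _ "(real n - real m, ?q g - 2 * real n - 1)"])
         (force simp: s_t monomial_grade_def algebra_simps)+
  qed
qed

theorem theorem3p18:
  fixes D :: link_diagram and \<sigma> :: "bool list \<Rightarrow> nat \<Rightarrow> int"
  assumes "oriented_link_diagram D"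
    and "anticommuting_signs D \<sigma>"
  shows "piecewise_linear_on 0 2 (s_t TYPE('a::field) D \<sigma>)
    \<and> continuous_on {0..2} (s_t TYPE('a) D \<sigma>)
    \<and> finite {t \<in> {0..2}. \<not> s_t TYPE('a) D \<sigma> differentiable (at t within {0..2})}"
proof -
  have "finite (edges D)" using assms(1) by (simp add: oriented_link_diagram_def)
  then obtain L :: "(real \<times> real) set" where L: "finite L"
      "continuous_on {0..2} (s_t TYPE('a) D \<sigma>)"
      "\<And>t. t \<in> {0..2} \<Longrightarrow> \<exists>(k, c) \<in> L. s_t TYPE('a) D \<sigma> t = k * t + c"
    using s_t_continuous_affine_selection[where ?'a = 'a and \<sigma> = \<sigma>] by blast
  then show ?thesis
    using continuous_affine_selection[OF L(1) _ L(2,3)] by simp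
qed

end
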